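(* There exists an absolute constant $C$ such that for every $n\in\mathbb{N}$ there exists a finite set $A\subset\mathbb{Q}$ with $|A|\geq n$ and $$|AA+A| \leq C\,\frac{|A|^2}{(\log\log |A|)^{2\ln 2 - 1 + o(1)}},$$ where $o(1)$ denotes a quantity tending to $0$ as $|A|\to\infty$.
   Context: For a finite set $A\subset\mathbb{R}$, $AA+A:=\{ab+c: a,b,c\in A\}$. Logarithms $\log$ are to base $2$ and $\ln$ is the natural logarithm. *)

theory Defs
  imports Complex_Main
begin

definition prod_plus_set :: "real set \<Rightarrow> real set" where
  "prod_plus_set A = {a * b + c | a b c. a \<in> A \<and> b \<in> A \<and> c \<in> A}"

end

theory Submission
  imports
    Defs
    "HOL-Analysis.Harmonic_Numbers"
    "HOL-Computational_Algebra.Squarefree"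
    "HOL-Real_Asymp.Real_Asymp"
begin

text \<open>Let \<open>P\<close> be the set of primes up to \<open>y\<close>, let \<open>q\<close> be the square of their product and let
  \<open>L = (\<Sum>p\<in>P. 1 / p)\<close>, which is at least \<open>ln (ln y) - O(1)\<close>. By Turan's variance argument at least
  half of the integers in \<open>{1..q}\<close> have \<open>L - sqrt (2 * L)\<close> or more prime divisors in \<open>P\<close>; \<open>A\<close> consists
  of these integers divided by \<open>q\<close>. Up to the factor \<open>q\<^sup>2\<close> every element of \<open>AA + A\<close> is
  \<open>a b + q c \<le> 2 q\<^sup>2\<close> and has essentially \<open>2 L\<close> prime divisors in \<open>P\<close> (with multiplicity), twice the
  normal number. Rankin's trick with weight \<open>2\<close> per prime bounds the number of such integers by
  \<open>O(q\<^sup>2 exp (L - 2 L ln 2 + O(sqrt L)))\<close>, while \<open>log (log |A|) = O(exp L)\<close>.\<close>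

section \<open>Exact mean of the Rankin weight over full periods\<close>

lemma card_multiples:
  fixes m N :: nat
  assumes "m > 0" "m dvd N"
  shows "real (card {x \<in> {1..N}. m dvd x}) = real N / real m"
proof -
  have "{x \<in> {1..N}. m dvd x} = (*) m ` {1..N div m}"
    using assms by (auto simp: image_iff elim!: dvdE)
  also have "card \<dots> = N div m"
    using assms by (subst card_image) (auto intro: inj_onI)
  finally show ?thesis
    using assms by (simp add: real_of_nat_div)
qed

text \<open>The factor at \<open>p\<close> is 1, 2 or 4 as \<open>p\<close> divides \<open>x\<close>
  to order 0, 1 or at least 2. Over full periods these factors are independent by the Chinese
  remainder theorem, so the mean is an Euler product with no error term. The modulus
  \<open>m\<close> makes the induction work: the powers of the removed prime are moved into
  it.\<close>

lemma sum_multiplicative_weight: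
  fixes P :: "nat set" and m N :: nat
  assumes "finite P" "\<And>p. p \<in> P \<Longrightarrow> prime p" "\<And>p. p \<in> P \<Longrightarrow> coprime m p" "m > 0"
    and "m * (\<Prod>p\<in>P. p\<^sup>2) dvd N"
  shows "(\<Sum>x | x \<in> {1..N} \<and> m dvd x. \<Prod>p\<in>P. 1 + of_bool (p dvd x) + 2 * of_bool (p\<^sup>2 dvd x))
           = real N / real m * (\<Prod>p\<in>P. 1 + 1 / real p + 2 / (real p)\<^sup>2)"
  using assms
proof (induction P arbitrary: m rule: finite_induct)
  case empty
  then show ?case using card_multiples[of m N] by simp
next
  case (insert p P)
  let ?W = "\<lambda>x. \<Prod>p\<in>P. 1 + of_bool (p dvd x) + 2 * of_bool (p\<^sup>2 dvd x) :: real"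
  let ?E = "\<Prod>p\<in>P. 1 + 1 / real p + 2 / (real p)\<^sup>2"
  let ?S = "\<lambda>m. \<Sum>x | x \<in> {1..N} \<and> m dvd x. ?W x"
  have p: "prime p" "p > 0" using insert.prems(1) by (auto simp: prime_gt_0_nat)
  have cop: "coprime p p'" if "p' \<in> P" for p'
    using that insert.hyps insert.prems(1) by (intro primes_coprime) auto
  have dvd: "m * p\<^sup>2 * (\<Prod>p\<in>P. p\<^sup>2) dvd N"
    using insert.prems(4) insert.hyps by (simp add: mult.assoc)
  have IH: "?S (m * p ^ k) = real N / real (m * p ^ k) * ?E" if "k \<le> 2" for k
  proof (rule insert.IH)
    show "m * p ^ k * (\<Prod>p\<in>P. p\<^sup>2) dvd N"
      using dvd by (rule dvd_trans[rotated]) (intro mult_dvd_mono dvd_refl le_imp_power_dvd that)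
  qed (use insert.prems p cop in auto)
  \<comment> \<open>By coprimality the indicator of \<open>p ^ k dvd x\<close> only enlarges the
    modulus; \<open>k = 0, 1, 2\<close> give the three terms of the factor at
    \<open>p\<close>.\<close>
  have S: "(\<Sum>x | x \<in> {1..N} \<and> m dvd x. of_bool (p ^ k dvd x) * ?W x) = ?S (m * p ^ k)" for k
  proof -
    have "coprime m (p ^ k)" using insert.prems(2)[of p] by simp
    then have "{x. x \<in> {1..N} \<and> m * p ^ k dvd x} = {x \<in> {x. x \<in> {1..N} \<and> m dvd x}. p ^ k dvd x}"
      by (auto intro: divides_mult dest: dvd_mult_left dvd_mult_right)
    then have "?S (m * p ^ k) = (\<Sum>x \<in> {x \<in> {x. x \<in> {1..N} \<and> m dvd x}. p ^ k dvd x}. ?W x)"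
      by (rule arg_cong)
    also have "\<dots> = (\<Sum>x | x \<in> {1..N} \<and> m dvd x. of_bool (p ^ k dvd x) * ?W x)"
      by (rule sum.mono_neutral_cong_left) auto
    finally show ?thesis by (rule sym)
  qed
  have "(\<Sum>x | x \<in> {1..N} \<and> m dvd x. \<Prod>p\<in>insert p P. 1 + of_bool (p dvd x) + 2 * of_bool (p\<^sup>2 dvd x))
     = (\<Sum>x | x \<in> {1..N} \<and> m dvd x. of_bool (p ^ 0 dvd x) * ?W x + of_bool (p ^ 1 dvd x) * ?W x
          + 2 * (of_bool (p ^ 2 dvd x) * ?W x))"
    using insert.hyps by (intro sum.cong) (simp_all add: algebra_simps)
  also have "\<dots> = ?S (m * p ^ 0) + ?S (m * p ^ 1) + 2 * ?S (m * p ^ 2)"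
    by (simp only: sum.distrib S flip: sum_distrib_left)
  also have "\<dots> = real N / real m * (1 + 1 / real p + 2 / (real p)\<^sup>2) * ?E"
    unfolding IH[of 0, OF zero_le] IH[of 1, OF one_le_numeral] IH[of 2, OF order_refl]
    by (simp add: divide_inverse algebra_simps)
  finally show ?case using insert.hyps by (simp add: mult.assoc)
qed

section \<open>Lower bound for the sum of prime reciprocals\<close>

lemma sum_inverse_squares_le:
  fixes S :: "nat set"
  assumes "finite S" "0 \<notin> S"
  shows "(\<Sum>n\<in>S. 1 / (real n)\<^sup>2) \<le> 2"
proof -
  \<comment> \<open>The extra \<open>1 / real k\<close> makes the bound telescope.\<close>
  have *: "(\<Sum>n=1..k. 1 / (real n)\<^sup>2) \<le> 2 - 1 / real k" if "k > 0" for k :: nat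
    using that
  proof (induction k rule: nat_induct_non_zero)
    case (Suc k)
    have "1 / (real (Suc k))\<^sup>2 \<le> 1 / real k - 1 / real (Suc k)"
      using Suc.hyps by (simp add: divide_simps power2_eq_square)
    with Suc show ?case by simp
  qed auto
  let ?k = "Suc (Max (insert 0 S))"
  have "S \<subseteq> {1..?k}" using assms
    by (auto simp: Suc_le_eq intro!: gr0I le_SucI Max_ge)
  then have "(\<Sum>n\<in>S. 1 / (real n)\<^sup>2) \<le> (\<Sum>n=1..?k. 1 / (real n)\<^sup>2)"
    by (intro sum_mono2) auto
  also have "\<dots> \<le> 2 - 1 / real ?k" by (intro *) simp
  also have "\<dots> \<le> 2" by simp
  finally show ?thesis .
qed

text \<open>Writing \<open>n = m\<^sup>2 k\<close> with \<open>k\<close> squarefree avoids Euler products of geometric series.\<close>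

lemma harm_le_exp_sum_prime_reciprocals:
  fixes y :: nat
  shows "harm y \<le> 2 * exp (\<Sum>p | prime p \<and> p \<le> y. 1 / real p)"
proof -
  let ?P = "{p. prime p \<and> p \<le> y}"
  have fin: "finite ?P" by simp
  \<comment> \<open>\<open>?f\<close> encodes \<open>n\<close> injectively, because a squarefree
    number is the product of its prime factors; \<open>?g\<close> recovers \<open>1 / n\<close> from
    the code.\<close>
  let ?f = "\<lambda>n::nat. (square_part n, prime_factors (squarefree_part n))"
  let ?g = "\<lambda>(m::nat, S::nat set). 1 / (real m)\<^sup>2 * (\<Prod>p\<in>S. 1 / real p)"
  have sf: "(\<Prod>p\<in>prime_factors (squarefree_part n). p) = squarefree_part n" for n :: nat
  proof -
    have "p ^ multiplicity p (squarefree_part n) = p" if "p \<in> prime_factors (squarefree_part n)" for p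
    proof -
      have "multiplicity p (squarefree_part n) \<le> Suc 0" "multiplicity p (squarefree_part n) > 0"
        using that by (auto simp: prime_factors_multiplicity)
      then show ?thesis by (simp add: le_Suc_eq)
    qed
    then have "(\<Prod>p\<in>prime_factors (squarefree_part n). p)
        = (\<Prod>p\<in>prime_factors (squarefree_part n). p ^ multiplicity p (squarefree_part n))"
      by (intro prod.cong) auto
    then show ?thesis by (simp add: prod_prime_factors)
  qed
  have dec: "n = squarefree_part n * (square_part n)\<^sup>2" for n :: nat
    by (rule squarefree_decompose)
  have inj: "inj_on ?f {1..y}"
  proof (rule inj_onI)
    fix a b assume "?f a = ?f b"
    then have sq: "square_part a = square_part b"
      and pf: "prime_factors (squarefree_part a) = prime_factors (squarefree_part b)"
      by (simp_all only: prod.inject)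
    have "squarefree_part a = squarefree_part b"
      by (rule trans[OF sf[symmetric] trans[OF _ sf]]) (simp only: pf)
    then show "a = b"
      by (intro trans[OF dec[of a] trans[OF _ dec[of b, symmetric]]]) (simp only: sq)
  qed
  have f_le: "square_part n \<in> {1..y}" "prime_factors (squarefree_part n) \<subseteq> ?P" if "n \<in> {1..y}" for n
  proof -
    have n: "n > 0" "n \<le> y" using that by auto
    have "square_part n dvd (square_part n)\<^sup>2" "(square_part n)\<^sup>2 dvd n" by simp_all
    then have "square_part n dvd n" by (rule dvd_trans)
    then have "square_part n \<le> n" using n by (auto dest: dvd_imp_le)
    moreover have "square_part n > 0" using n by (intro gr0I) simp
    ultimately show "square_part n \<in> {1..y}" unfolding atLeastAtMost_iff using n by linarith
    show "prime_factors (squarefree_part n) \<subseteq> ?P"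
    proof
      fix p assume p: "p \<in> prime_factors (squarefree_part n)"
      then have "p dvd squarefree_part n" by auto
      then have "p dvd n" by (subst dec[of n]) (rule dvd_mult2)
      then show "p \<in> ?P" using p n by (auto dest: dvd_imp_le)
    qed
  qed
  have "harm y = (\<Sum>n=1..y. 1 / real n)" by (simp add: harm_def field_simps)
  also have "\<dots> = (\<Sum>n=1..y. ?g (?f n))"
  proof (rule sum.cong)
    fix n
    have "1 / real n = 1 / real (squarefree_part n * (square_part n)\<^sup>2)"
      by (rule arg_cong[OF dec])
    also have "\<dots> = 1 / (real (square_part n))\<^sup>2 * (1 / real (squarefree_part n))" by simp
    also have "real (squarefree_part n) = (\<Prod>p\<in>prime_factors (squarefree_part n). real p)"
      by (subst sf[symmetric]) simp
    finally show "1 / real n = ?g (?f n)" by (simp add: prod_dividef)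
  qed simp
  also have "\<dots> = (\<Sum>x\<in>?f ` {1..y}. ?g x)" by (simp only: sum.reindex[OF inj] o_def)
  \<comment> \<open>Allowing all pairs, not just codes of numbers up to \<open>y\<close>, makes the
    sum factor; the sum over subsets is then an expanded product.\<close>
  also have "\<dots> \<le> (\<Sum>x\<in>{1..y} \<times> Pow ?P. ?g x)"
  proof (rule sum_mono2)
    show "?f ` {1..y} \<subseteq> {1..y} \<times> Pow ?P" using f_le by (intro image_subsetI SigmaI PowI)
  qed (auto intro!: prod_nonneg divide_nonneg_nonneg)
  also have "\<dots> = (\<Sum>m=1..y. 1 / (real m)\<^sup>2) * (\<Sum>S\<in>Pow ?P. \<Prod>p\<in>S. 1 / real p)"
    by (simp add: sum_product sum.cartesian_product case_prod_unfold)
  also have "(\<Sum>S\<in>Pow ?P. \<Prod>p\<in>S. 1 / real p) = (\<Prod>p\<in>?P. 1 / real p + 1)"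
    by (simp add: prod_add)
  also have "(\<Sum>m=1..y. 1 / (real m)\<^sup>2) * \<dots> \<le> 2 * exp (\<Sum>p\<in>?P. 1 / real p)"
  proof (rule mult_mono)
    show "(\<Prod>p\<in>?P. 1 / real p + 1) \<le> exp (\<Sum>p\<in>?P. 1 / real p)"
      unfolding exp_sum[OF fin] by (intro prod_mono) (auto simp: add.commute intro: exp_ge_add_one_self)
  qed (use sum_inverse_squares_le[of "{1..y}"] in \<open>auto intro: prod_nonneg\<close>)
  finally show ?thesis .
qed

section \<open>Turan's variance argument\<close>

definition omega :: "nat set \<Rightarrow> nat \<Rightarrow> real" where
  "omega P x = (\<Sum>p\<in>P. of_bool (p dvd x))"

text \<open>As \<open>\<Prod>P\<close> divides \<open>N\<close>, divisibility by distinct primes of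
  \<open>P\<close> is exactly independent on \<open>{1..N}\<close>. The covariances vanish, and each
  diagonal term is at most \<open>N / p\<close>.\<close>

lemma omega_variance:
  fixes P :: "nat set" and N :: nat
  assumes "finite P" "\<And>p. p \<in> P \<Longrightarrow> prime p" "\<Prod>P dvd N"
  defines "L \<equiv> \<Sum>p\<in>P. 1 / real p"
  shows "(\<Sum>x=1..N. (omega P x - L)\<^sup>2) \<le> real N * L"
proof -
  have pos: "p > 0" if "p \<in> P" for p using assms(2)[OF that] by (simp add: prime_gt_0_nat)
  have dv: "p dvd N" if "p \<in> P" for p
    using that assms(1,3) by (metis dvd_prodI dvd_trans)
  have cnt: "(\<Sum>x=1..N. of_bool (m dvd x)) = real N / real m" if "m > 0" "m dvd N" for m
    using card_multiples[OF that] by (simp add: sum.If_cases of_bool_def Int_def)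
  have cov: "(\<Sum>x=1..N. (of_bool (p dvd x) - 1 / real p) * (of_bool (p' dvd x) - 1 / real p'))
       \<le> (if p = p' then real N / real p else 0)" if "p \<in> P" "p' \<in> P" for p p'
  proof -
    note pp = pos[OF that(1)] pos[OF that(2)]
    have "(\<Sum>x=1..N. (of_bool (p dvd x) - 1 / real p) * (of_bool (p' dvd x) - 1 / real p'))
        = (\<Sum>x=1..N. of_bool (p dvd x \<and> p' dvd x) - 1 / real p' * of_bool (p dvd x)
             - 1 / real p * of_bool (p' dvd x) + 1 / (real p * real p'))"
      using pp by (intro sum.cong) (auto simp: of_bool_def field_simps)
    also have "\<dots> = (\<Sum>x=1..N. of_bool (p dvd x \<and> p' dvd x)) - real N / (real p * real p')"
      unfolding sum.distrib sum_subtractf sum_distrib_left[symmetric] cnt[OF pp(1) dv[OF that(1)]]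
        cnt[OF pp(2) dv[OF that(2)]] by simp
    also have "\<dots> \<le> (if p = p' then real N / real p else 0)"
    proof (cases "p = p'")
      case True
      then show ?thesis using cnt[OF pp(1) dv[OF that(1)]] by simp
    next
      case False
      then have cop: "coprime p p'" using that assms(2) by (intro primes_coprime) auto
      then have "p * p' dvd N" using that dv by (intro divides_mult) auto
      moreover have "(p dvd x \<and> p' dvd x) = (p * p' dvd x)" for x
        using cop by (auto intro: divides_mult dest: dvd_mult_left dvd_mult_right)
      ultimately show ?thesis using cnt[of "p * p'"] pp False by simp
    qed
    finally show ?thesis .
  qed
  have "(\<Sum>x=1..N. (omega P x - L)\<^sup>2)
      = (\<Sum>x=1..N. \<Sum>p\<in>P. \<Sum>p'\<in>P. (of_bool (p dvd x) - 1 / real p) * (of_bool (p' dvd x) - 1 / real p'))"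
    by (simp add: omega_def L_def power2_eq_square sum_product flip: sum_subtractf)
  also have "\<dots> = (\<Sum>p\<in>P. \<Sum>p'\<in>P. \<Sum>x=1..N. (of_bool (p dvd x) - 1 / real p) * (of_bool (p' dvd x) - 1 / real p'))"
    by (subst sum.swap, rule sum.cong[OF refl], rule sum.swap)
  also have "\<dots> \<le> (\<Sum>p\<in>P. \<Sum>p'\<in>P. if p = p' then real N / real p else 0)"
    by (intro sum_mono cov)
  also have "\<dots> = real N * L"
    using assms(1) by (simp add: L_def sum_distrib_left)
  finally show ?thesis .
qed

text \<open>Chebyshev's inequality: each exceptional \<open>x\<close> contributes at least
  \<open>2 * L\<close> to a total of at most \<open>N * L\<close>, so there are at most
  \<open>N / 2\<close> of them.\<close>

lemma card_omega_ge:
  fixes P :: "nat set" and N :: nat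
  assumes "finite P" "\<And>p. p \<in> P \<Longrightarrow> prime p" "\<Prod>P dvd N" "P \<noteq> {}"
  defines "L \<equiv> \<Sum>p\<in>P. 1 / real p"
  shows "real N / 2 \<le> real (card {x \<in> {1..N}. L - sqrt (2 * L) \<le> omega P x})"
proof -
  let ?G = "{x \<in> {1..N}. L - sqrt (2 * L) \<le> omega P x}"
  let ?B = "{x \<in> {1..N}. \<not> L - sqrt (2 * L) \<le> omega P x}"
  have L: "L > 0"
    unfolding L_def using assms(1,2,4) by (intro sum_pos) (auto simp: prime_gt_0_nat)
  have "real (card ?B) * (2 * L) = (\<Sum>x\<in>?B. 2 * L)" by simp
  also have "\<dots> \<le> (\<Sum>x\<in>?B. (omega P x - L)\<^sup>2)"
  proof (rule sum_mono)
    fix x assume "x \<in> ?B"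
    then have "sqrt (2 * L) \<le> L - omega P x" by auto
    then have "(sqrt (2 * L))\<^sup>2 \<le> (L - omega P x)\<^sup>2" using L by (intro power_mono) auto
    then show "2 * L \<le> (omega P x - L)\<^sup>2" using L by (simp add: power2_commute)
  qed
  also have "\<dots> \<le> (\<Sum>x=1..N. (omega P x - L)\<^sup>2)" by (intro sum_mono2) auto
  also have "\<dots> \<le> real N * L" using omega_variance assms by blast
  finally have "real (card ?B) \<le> real N / 2" using L by (simp add: field_simps)
  moreover have "card ?G + card ?B = card (?G \<union> ?B)" by (intro card_Un_disjoint[symmetric]) auto
  moreover have "?G \<union> ?B = {1..N}" by auto
  ultimately show ?thesis by simp
qed

section \<open>Construction of the set and the count of \<open>AA + A\<close>\<close>

text \<open>After scaling by \<open>q\<^sup>2\<close> the elements of \<open>AA + A\<close> become \<open>a b + q c\<close>, and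
  \<open>p\<^sup>2 dvd q\<close> lets them inherit the small prime factors of \<open>a b\<close>.\<close>

lemma weight_ge_powr:
  fixes P :: "nat set" and a b c q :: nat
  assumes "finite P" "\<And>p. p \<in> P \<Longrightarrow> p\<^sup>2 dvd q"
  shows "2 powr (omega P a + omega P b)
    \<le> (\<Prod>p\<in>P. 1 + of_bool (p dvd a * b + q * c) + 2 * of_bool (p\<^sup>2 dvd a * b + q * c))"
proof -
  have "2 powr (omega P a + omega P b) = (\<Prod>p\<in>P. 2 powr (of_bool (p dvd a) + of_bool (p dvd b)))"
    unfolding omega_def sum.distrib[symmetric] using assms(1) by (intro powr_sum) auto
  also have "\<dots> \<le> (\<Prod>p\<in>P. 1 + of_bool (p dvd a * b + q * c) + 2 * of_bool (p\<^sup>2 dvd a * b + q * c))"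
  proof (rule prod_mono, intro conjI)
    fix p assume "p \<in> P"
    then have q: "p\<^sup>2 dvd q * c" "p dvd q * c"
      using assms(2)[of p] by (auto intro: dvd_mult2 dvd_trans[of p "p\<^sup>2"])
    have "p dvd a * b + q * c" if "p dvd a \<or> p dvd b" using that q by auto
    moreover have "p\<^sup>2 dvd a * b + q * c" if "p dvd a" "p dvd b"
      using that q by (auto simp: power2_eq_square intro: mult_dvd_mono dvd_add)
    ultimately show "2 powr (of_bool (p dvd a) + of_bool (p dvd b))
      \<le> (1 + of_bool (p dvd a * b + q * c) + 2 * of_bool (p\<^sup>2 dvd a * b + q * c) :: real)"
      by (auto simp: of_bool_def)
  qed auto
  finally show ?thesis .
qed

text \<open>In the constant, 2 comes from the range \<open>2 * q\<^sup>2\<close>, 4 from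
  \<open>q \<le> 2 * card A\<close>, and \<open>exp 4\<close> from the terms
  \<open>2 / p\<^sup>2\<close> of the Euler product. The \<open>sqrt L\<close> term is the cost of
  the Turan deviation.\<close>

lemma exists_small_prod_plus_set:
  fixes P :: "nat set"
  assumes "finite P" "\<And>p. p \<in> P \<Longrightarrow> prime p" "P \<noteq> {}"
  defines "L \<equiv> \<Sum>p\<in>P. 1 / real p"
  shows "\<exists>A. finite A \<and> A \<subseteq> \<rat> \<and> (real (\<Prod>P))\<^sup>2 / 2 \<le> real (card A) \<and> card A \<le> (\<Prod>P)\<^sup>2 \<and>
    real (card (prod_plus_set A))
      \<le> 8 * exp 4 * (real (card A))\<^sup>2 * exp (- ((2 * ln 2 - 1) * L - 2 * sqrt 2 * ln 2 * sqrt L))"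
proof -
  define q where "q = (\<Prod>P)\<^sup>2"
  define T where "T = L - sqrt (2 * L)"
  define G where "G = {x \<in> {1..q}. T \<le> omega P x}"
  \<comment> \<open>Dividing by \<open>q\<close> turns \<open>c\<close> into \<open>q * c\<close>
    over the common denominator \<open>q\<^sup>2\<close>, so adding it preserves divisibility by
    \<open>p\<close> and \<open>p\<^sup>2\<close>.\<close>
  define A where "A = (\<lambda>x. real x / real q) ` G"
  define W :: "nat \<Rightarrow> real"
    where "W x = (\<Prod>p\<in>P. 1 + of_bool (p dvd x) + 2 * of_bool (p\<^sup>2 dvd x))" for x
  \<comment> \<open>Both \<open>a\<close> and \<open>b\<close> contribute \<open>T\<close> to the
    exponent; the range is \<open>2 * q\<^sup>2\<close> because \<open>a * b\<close> and
    \<open>q * c\<close> are each at most \<open>q\<^sup>2\<close>.\<close>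
  define X where "X = {x \<in> {1..2 * q\<^sup>2}. 2 powr (2 * T) \<le> W x}"
  have pos: "p > 0" if "p \<in> P" for p using assms(2)[OF that] by (simp add: prime_gt_0_nat)
  have q: "q > 0" using pos by (auto simp: q_def intro!: prod_pos)
  have q_eq: "q = (\<Prod>p\<in>P. p\<^sup>2)" by (simp add: q_def prod_power_distrib)
  have psq: "p\<^sup>2 dvd q" if "p \<in> P" for p
    using that assms(1) dvd_prodI[of P p "\<lambda>p. p\<^sup>2"] by (simp add: q_eq)
  have fin: "finite G" "finite X" by (simp_all add: G_def X_def)
  have cardA: "card A = card G"
    unfolding A_def using q by (intro card_image inj_onI) simp
  have "real q / 2 \<le> real (card G)"
    unfolding G_def T_def L_def using assms(1-3) by (intro card_omega_ge) (auto simp: q_def)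
  then have lower: "real q / 2 \<le> real (card A)" by (simp add: cardA)
  have "card G \<le> card {1..q}" by (intro card_mono) (auto simp: G_def)
  then have upper: "card A \<le> q" by (simp add: cardA)
  have "prod_plus_set A \<subseteq> (\<lambda>x. real x / (real q)\<^sup>2) ` X"
  proof
    fix z assume "z \<in> prod_plus_set A"
    then obtain a b c where G: "a \<in> G" "b \<in> G" "c \<in> G"
      and z: "z = real a / real q * (real b / real q) + real c / real q"
      by (auto simp: prod_plus_set_def A_def)
    have "2 powr (2 * T) \<le> 2 powr (omega P a + omega P b)" using G by (simp add: G_def)
    also have "\<dots> \<le> W (a * b + q * c)"
      unfolding W_def using assms(1) psq by (rule weight_ge_powr)
    finally have "2 powr (2 * T) \<le> W (a * b + q * c)" .
    moreover have "a * b \<le> q\<^sup>2" "q * c \<le> q\<^sup>2" "a * b > 0"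
      using G by (auto simp: G_def power2_eq_square intro: mult_le_mono)
    then have "a * b + q * c \<in> {1..2 * q\<^sup>2}" unfolding atLeastAtMost_iff by linarith
    ultimately have "a * b + q * c \<in> X" by (simp add: X_def)
    moreover have "z = real (a * b + q * c) / (real q)\<^sup>2"
      using q by (simp add: z field_simps power2_eq_square)
    ultimately show "z \<in> (\<lambda>x. real x / (real q)\<^sup>2) ` X" by blast
  qed
  then have "card (prod_plus_set A) \<le> card X" using fin(2) by (meson surj_card_le)
  then have "real (card (prod_plus_set A)) \<le> real (card X)" by simp
  also have "real (card X) \<le> 2 * (real q)\<^sup>2 * exp (L + 4) * 2 powr (- 2 * T)"
  proof -
    \<comment> \<open>Rankin's trick is Markov's inequality for \<open>W\<close>.\<close>
    have "real (card X) * 2 powr (2 * T) = (\<Sum>x\<in>X. 2 powr (2 * T))" by simp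
    also have "\<dots> \<le> (\<Sum>x\<in>X. W x)" by (intro sum_mono) (simp add: X_def)
    \<comment> \<open>The vacuous \<open>1 dvd x\<close> matches the weighted sum at
      \<open>m = 1\<close>; its period \<open>q\<close> divides
      \<open>2 * q\<^sup>2\<close>.\<close>
    also have "\<dots> \<le> (\<Sum>x | x \<in> {1..2 * q\<^sup>2} \<and> 1 dvd x. W x)"
      by (intro sum_mono2) (auto simp: X_def W_def intro!: prod_nonneg)
    also have "\<dots> = real (2 * q\<^sup>2) / real 1 * (\<Prod>p\<in>P. 1 + 1 / real p + 2 / (real p)\<^sup>2)"
      unfolding W_def using assms(1,2)
      by (intro sum_multiplicative_weight) (auto simp: power2_eq_square[of q] simp flip: q_eq)
    also have "\<dots> \<le> real (2 * q\<^sup>2) / real 1 * exp (\<Sum>p\<in>P. 1 / real p + 2 / (real p)\<^sup>2)"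
      unfolding exp_sum[OF assms(1)]
      by (intro mult_left_mono prod_mono conjI)
        (simp_all add: add.assoc exp_ge_add_one_self add_nonneg_nonneg)
    also have "(\<Sum>p\<in>P. 1 / real p + 2 / (real p)\<^sup>2) = L + 2 * (\<Sum>p\<in>P. 1 / (real p)\<^sup>2)"
      by (simp add: L_def sum.distrib sum_distrib_left)
    also have "real (2 * q\<^sup>2) / real 1 * exp \<dots> \<le> 2 * (real q)\<^sup>2 * exp (L + 4)"
      using sum_inverse_squares_le[of P] assms(1) pos by (force intro: mult_left_mono)
    finally show ?thesis by (simp add: powr_minus field_simps)
  qed
  also have "\<dots> \<le> 2 * (2 * real (card A))\<^sup>2 * exp (L + 4) * 2 powr (- 2 * T)"
    using lower by (intro mult_right_mono mult_left_mono power_mono) auto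
  also have "\<dots> = 8 * exp 4 * (real (card A))\<^sup>2 * (exp L * 2 powr (- 2 * T))"
    by (simp add: exp_add power_mult_distrib)
  also have "exp L * 2 powr (- 2 * T) = exp (- ((2 * ln 2 - 1) * L - 2 * sqrt 2 * ln 2 * sqrt L))"
    by (simp add: powr_def T_def real_sqrt_mult algebra_simps flip: exp_add)
  finally have "real (card (prod_plus_set A))
      \<le> 8 * exp 4 * (real (card A))\<^sup>2 * exp (- ((2 * ln 2 - 1) * L - 2 * sqrt 2 * ln 2 * sqrt L))" .
  moreover have "A \<subseteq> \<rat>" by (auto simp: A_def)
  ultimately show ?thesis
    using fin lower upper by (intro exI[of _ A]) (simp add: A_def q_def)
qed

section \<open>From the prime sum to the iterated logarithm\<close>

text \<open>Two logarithms make the crude bound \<open>m \<le> y ^ (2 * y)\<close> good enough: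
  \<open>log 2 m \<le> y ^ 3\<close>, and \<open>ln y\<close> is at most the harmonic sum. The
  constant is \<open>3 * (3 / 2) * 2\<close>, from the cube, from \<open>ln 2 \<ge> 2 / 3\<close>
  and from the harmonic bound.\<close>

lemma log_log_le_exp_sum_prime_reciprocals:
  fixes y m :: nat
  assumes "y \<ge> 2" "m > 1" "m \<le> (\<Prod>{p. prime p \<and> p \<le> y})\<^sup>2"
  shows "log 2 (log 2 (real m)) \<le> 9 * exp (\<Sum>p | prime p \<and> p \<le> y. 1 / real p)"
proof -
  let ?P = "{p. prime p \<and> p \<le> y}"
  have "\<Prod>?P \<le> (\<Prod>p\<in>?P. y)" by (intro prod_mono) auto
  also have "\<dots> = y ^ card ?P" by simp
  also have "\<dots> \<le> y ^ y"
  proof (rule power_increasing)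
    have "card ?P \<le> card {1..y}"
      by (intro card_mono) (auto simp: Suc_le_eq prime_gt_0_nat)
    then show "card ?P \<le> y" by simp
  qed (use assms in simp)
  finally have "(\<Prod>?P)\<^sup>2 \<le> (y ^ y)\<^sup>2" by (rule power_mono) simp
  then have "m \<le> y ^ (2 * y)" using assms(3) by (simp add: mult.commute flip: power_mult)
  then have "real m \<le> real y ^ (2 * y)" by (simp flip: of_nat_power)
  then have "log 2 (real m) \<le> log 2 (real y ^ (2 * y))" using assms by simp
  also have "\<dots> = real (2 * y) * log 2 (real y)" using assms by (simp only: log_nat_power)
  also have "\<dots> \<le> real (2 * y) * real y"
  proof (rule mult_left_mono)
    have "real y \<le> 2 ^ y" using less_exp[of y] by (metis less_imp_le of_nat_le_iff of_nat_numeral of_nat_power)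
    then show "log 2 (real y) \<le> real y" using assms by (simp add: log_le_iff powr_realpow)
  qed simp
  also have "\<dots> \<le> real y ^ 3"
    using assms by (simp add: power3_eq_cube mult_mono)
  finally have "log 2 (log 2 (real m)) \<le> log 2 (real y ^ 3)" using assms by simp
  also have "\<dots> = 3 * (ln (real y) / ln 2)"
    using assms by (simp only: log_def ln_realpow)
  also have "\<dots> \<le> 3 * (ln (real y) / (2 / 3))"
    using assms ln2_ge_two_thirds by (intro mult_left_mono divide_left_mono) auto
  also have "ln (real y) \<le> harm y"
    using ln_le_harm[of y] assms by (intro order.trans[OF _ ln_le_harm]) simp
  also note harm_le_exp_sum_prime_reciprocals[of y]
  finally show ?thesis by simp
qed

text \<open>Allows a lower bound for \<open>L\<close> to replace \<open>L\<close> in the exponent.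
  Writing \<open>L - t\<close> as a difference of squares reduces the claim to
  \<open>K \<le> c * (sqrt L + sqrt t)\<close>.\<close>

lemma linear_minus_sqrt_mono:
  fixes c K t L :: real
  assumes "c > 0" "K > 0" "(K / c)\<^sup>2 \<le> t" "t \<le> L"
  shows "c * t - K * sqrt t \<le> c * L - K * sqrt L"
proof -
  have t: "t \<ge> 0" using assms(3) by (rule order.trans[rotated]) simp
  have "K / c \<le> sqrt t" using assms(3) by (rule real_le_rsqrt)
  then have "K / c \<le> sqrt L + sqrt t" using assms t by (simp add: add_increasing)
  then have "K \<le> c * (sqrt L + sqrt t)" using assms(1) by (simp add: field_simps)
  then have "K * (sqrt L - sqrt t) \<le> c * (sqrt L + sqrt t) * (sqrt L - sqrt t)"
    using assms(4) by (intro mult_right_mono) auto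
  also have "\<dots> = c * (L - t)"
    using t assms(4) by (simp add: algebra_simps)
  finally show ?thesis by (simp add: algebra_simps)
qed

theorem theorem5:
  "\<exists>(C::real) (\<epsilon> :: nat \<Rightarrow> real). \<epsilon> \<longlonglongrightarrow> 0 \<and>
     (\<forall>n::nat. \<exists>A :: real set. finite A \<and> A \<subseteq> \<rat> \<and> n \<le> card A \<and>
        real (card (prod_plus_set A)) \<le>
          C * ((real (card A))\<^sup>2 /
            (log 2 (log 2 (real (card A)))) powr (2 * ln 2 - 1 + \<epsilon> (card A))))"
proof -
  define c :: real where "c = 2 * ln 2 - 1"
  define K :: real where "K = 2 * sqrt 2 * ln 2"
  define d :: real where "d = ln 9"
  define l :: "nat \<Rightarrow> real" where "l = (\<lambda>n. log 2 (log 2 (real n)))"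
  \<comment> \<open>Chosen so that \<open>l n powr \<epsilon> n\<close> equals
    \<open>exp (- K * sqrt (ln (l n)))\<close> once \<open>l n > 1\<close>. Values at small
    \<open>n\<close> are harmless, since \<open>card A\<close> will exceed a threshold.\<close>
  define \<epsilon> :: "nat \<Rightarrow> real" where "\<epsilon> = (\<lambda>n. - K / sqrt (ln (l n)))"
  have c: "c > 0" using ln2_ge_two_thirds by (simp add: c_def)
  have K: "K > 0" by (simp add: K_def)
  have d: "d > 0" by (simp add: d_def)
  have "\<epsilon> \<longlonglongrightarrow> 0" unfolding \<epsilon>_def l_def by real_asymp
  moreover have "\<exists>A. finite A \<and> A \<subseteq> \<rat> \<and> n \<le> card A \<and> real (card (prod_plus_set A)) \<le>
      8 * exp 4 * exp (c * d) * ((real (card A))\<^sup>2 / l (card A) powr (c + \<epsilon> (card A)))" for n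
  proof -
    have l1: "\<forall>\<^sub>F N in sequentially. l N > 1" unfolding l_def by real_asymp
    have "filterlim (\<lambda>N. ln (l N)) at_top sequentially" unfolding l_def by real_asymp
    \<comment> \<open>This threshold makes the monotonicity lemma applicable at
      \<open>t = \<tau> - d\<close>.\<close>
    then have l2: "\<forall>\<^sub>F N in sequentially. d + (K / c)\<^sup>2 \<le> ln (l N)"
      by (simp add: filterlim_at_top)
    obtain N where N: "l m > 1" "d + (K / c)\<^sup>2 \<le> ln (l m)" if "m \<ge> N" for m
      using eventually_conj[OF l1 l2] unfolding eventually_sequentially by blast
    \<comment> \<open>A prime \<open>y\<close> lies in \<open>P\<close>, so \<open>card A\<close> is
      at least \<open>(\<Prod>P)\<^sup>2 / 2 \<ge> y / 2\<close>, which exceeds \<open>n\<close>,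
      \<open>N\<close> and 1.\<close>
    obtain y where y: "prime y" "y > 2 * (n + N + 2)" using bigger_prime by blast
    define P where "P = {p. prime p \<and> p \<le> y}"
    define L where "L = (\<Sum>p\<in>P. 1 / real p)"
    have P: "finite P" "\<And>p. p \<in> P \<Longrightarrow> prime p" "y \<in> P" using y by (auto simp: P_def)
    obtain A where A: "finite A" "A \<subseteq> \<rat>" "(real (\<Prod>P))\<^sup>2 / 2 \<le> real (card A)" "card A \<le> (\<Prod>P)\<^sup>2"
      and bound: "real (card (prod_plus_set A))
        \<le> 8 * exp 4 * (real (card A))\<^sup>2 * exp (- (c * L - K * sqrt L))"
      using exists_small_prod_plus_set[OF P(1,2)] P(3) unfolding L_def c_def K_def by blast
    have "\<Prod>P > 0" using P(2) by (auto intro!: prod_pos simp: prime_gt_0_nat)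
    moreover have "y dvd \<Prod>P" using P dvd_prodI[of P y "\<lambda>p. p"] by simp
    ultimately have "y \<le> \<Prod>P" by (rule dvd_imp_le[rotated])
    also have "\<dots> \<le> (\<Prod>P)\<^sup>2" by (simp add: power2_eq_square)
    finally have "real y \<le> real ((\<Prod>P)\<^sup>2)" by (rule of_nat_mono)
    then have "real y \<le> (real (\<Prod>P))\<^sup>2" by (simp only: of_nat_power)
    with A(3) y(2) have "real (card A) \<ge> real (n + N + 2)" by simp
    then have cardA: "card A \<ge> n" "card A \<ge> N" "card A > 1" by linarith+
    define \<tau> where "\<tau> = ln (l (card A))"
    have l: "l (card A) > 1" and \<tau>: "d + (K / c)\<^sup>2 \<le> \<tau>"
      using N[OF cardA(2)] by (auto simp: \<tau>_def)
    have "l (card A) \<le> 9 * exp L"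
      unfolding l_def L_def P_def using y A(4) cardA(3)
      by (intro log_log_le_exp_sum_prime_reciprocals) (auto simp: P_def)
    then have "\<tau> \<le> ln (9 * exp L)" using l by (simp add: \<tau>_def)
    then have "\<tau> - d \<le> L" by (simp add: d_def ln_mult)
    then have "c * (\<tau> - d) - K * sqrt (\<tau> - d) \<le> c * L - K * sqrt L"
      using c K \<tau> by (intro linear_minus_sqrt_mono) auto
    moreover have "K * sqrt (\<tau> - d) \<le> K * sqrt \<tau>" using K d by simp
    \<comment> \<open>The loss \<open>c * d\<close>, caused by the factor 9, is constant and goes
      into \<open>C\<close> as \<open>exp (c * d)\<close>.\<close>
    ultimately have *: "c * \<tau> - K * sqrt \<tau> - c * d \<le> c * L - K * sqrt L"
      by (simp add: algebra_simps)
    have "\<tau> > 0" using \<tau> d by (rule order.strict_trans2[OF add_pos_nonneg[OF _ zero_le_power2], rotated])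
    then have "K * (\<tau> / sqrt \<tau>) = K * sqrt \<tau>" by (simp only: real_div_sqrt order_less_imp_le)
    then have "(c + \<epsilon> (card A)) * \<tau> = c * \<tau> - K * sqrt \<tau>"
      by (simp add: \<epsilon>_def \<tau>_def[symmetric] algebra_simps)
    then have powr: "l (card A) powr (c + \<epsilon> (card A)) = exp (c * \<tau> - K * sqrt \<tau>)"
      using l by (simp add: powr_def \<tau>_def)
    have "exp (- (c * L - K * sqrt L)) \<le> exp (c * d - (c * \<tau> - K * sqrt \<tau>))"
      using * by simp
    also have "\<dots> = exp (c * d) / l (card A) powr (c + \<epsilon> (card A))"
      by (simp add: exp_diff powr)
    finally have "8 * exp 4 * (real (card A))\<^sup>2 * exp (- (c * L - K * sqrt L))
      \<le> 8 * exp 4 * (real (card A))\<^sup>2 * (exp (c * d) / l (card A) powr (c + \<epsilon> (card A)))"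
      by (rule mult_left_mono) simp
    with bound A(1,2) cardA(1) show ?thesis
      by (intro exI[of _ A]) (simp add: mult_ac)
  qed
  ultimately show ?thesis unfolding c_def l_def by blast
qed

end
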